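(* Let $f:\operatorname{dom} f\to\mathbb{R}$ be a function with convex domain $\operatorname{dom} f\subseteq\mathbb{E}$ satisfying the Regularity Assumption. Then for any $t\in\Gamma$ and $\beta\in[0,1]$, $$\hat\mu(\beta t)\ \ge\ \beta^2\,\hat\mu(t).$$
   Context: $\mathbb{E}$ is a finite-dimensional real linear space with an arbitrary fixed norm $\|\cdot\|$. The function $f$ is not necessarily convex. Global Curvature Bound of $f$: $$\hat\mu(t)=\sup_{x,y\in\operatorname{dom} f,\ \alpha\in(0,1)}\Big\{\frac{|\alpha f(x)+(1-\alpha)f(y)-f(\alpha x+(1-\alpha)y)|}{\alpha(1-\alpha)}:\ \|x-y\|\le t\Big\}.$$ Let $D=\operatorname{diam}(\operatorname{dom} f)$; $\Gamma=[0,D]$ if $D<+\infty$ and $\Gamma=[0,+\infty)$ otherwise. Regularity Assumption: $\hat\mu(t)$ is well defined (finite) for all $t\in\Gamma$, and $\lim_{\tau\to+0}\frac1\tau\hat\mu(\tau)=0$. *)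

theory Defs
  imports "HOL-Analysis.Analysis"
begin

(* A function with domain S is a total function f of which only the values on S are used. *)

definition global_curvature_bound ::
    "'a::real_normed_vector set \<Rightarrow> ('a \<Rightarrow> real) \<Rightarrow> real \<Rightarrow> ereal" where
  "global_curvature_bound S f t =
     Sup {ereal (\<bar>\<alpha> * f x + (1 - \<alpha>) * f y - f (\<alpha> *\<^sub>R x + (1 - \<alpha>) *\<^sub>R y)\<bar> / (\<alpha> * (1 - \<alpha>))) | x y \<alpha>.
            x \<in> S \<and> y \<in> S \<and> 0 < \<alpha> \<and> \<alpha> < 1 \<and> norm (x - y) \<le> t}"

(* diameter takes only real values, so an infinite diameter has to be expressed as unboundedness. *)
definition diam_range :: "'a::real_normed_vector set \<Rightarrow> real set" where
  "diam_range S = (if bounded S then {0..diameter S} else {0..})"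

(* Excluding both infinite values also forces S to be nonempty, since the supremum of the
   empty set is minus infinity in ereal. *)
definition curvature_regular :: "'a::real_normed_vector set \<Rightarrow> ('a \<Rightarrow> real) \<Rightarrow> bool" where
  "curvature_regular S f \<longleftrightarrow>
     (\<forall>t\<in>diam_range S. \<bar>global_curvature_bound S f t\<bar> \<noteq> \<infinity>) \<and>
     ((\<lambda>\<tau>. ereal (1 / \<tau>) * global_curvature_bound S f \<tau>) \<longlongrightarrow> 0) (at_right 0)"

end

theory Submission
  imports Defs
begin

text \<open>
  For \<open>\<beta> = 0\<close> the claim is that the curvature bound is nonnegative, and it is void if
  the bound at \<open>\<beta> t\<close> is infinite. Otherwise everything happens on one segment. Fix \<open>x, y \<in> S\<close> with \<open>norm (x - y) \<le> t\<close>, put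
  \<open>\<phi> s = f (s x + (1 - s) y)\<close> and let \<open>M\<close> be the curvature bound at \<open>\<beta> t\<close>. Two
  parameters at distance at most \<open>\<beta>\<close> give points at distance at most \<open>\<beta> t\<close>, so the Jensen
  gap of \<open>\<phi>\<close> on such a pair is at most \<open>\<alpha> (1 - \<alpha>) M\<close> in absolute value. On a pair at
  distance exactly \<open>\<beta>\<close> this is the Jensen gap of the parabola \<open>(M / \<beta>\<^sup>2) s\<^sup>2\<close>. Hence
  the difference between \<open>\<phi>\<close> and its chord over \<open>[0, 1]\<close>, taken with either sign and
  corrected by \<open>- (M / \<beta>\<^sup>2) s (1 - s)\<close>, vanishes at \<open>0\<close> and \<open>1\<close> and satisfies Jensen's
  inequality on every subinterval of length \<open>\<beta>\<close>.

  A continuous function of this kind is nonpositive, by a maximum principle: an interval of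
  length \<open>\<beta>\<close> around the leftmost point of a positive maximum would push the maximum further
  to the left (\<open>nonpos_if_convex_on_fixed_length\<close>). Nonpositivity for both signs bounds the
  gap over \<open>[0, 1]\<close> by \<open>\<alpha> (1 - \<alpha>) M / \<beta>\<^sup>2\<close>, which is the claim. The required continuity
  comes from the factor \<open>\<alpha> (1 - \<alpha>)\<close>: it makes the gap vanish linearly as \<open>\<alpha>\<close> tends to
  \<open>0\<close> (\<open>continuous_on_if_Jensen_gap_bounded\<close>).
\<close>

section \<open>Functions of one variable with controlled Jensen gap\<close>

text \<open>
  With \<open>q = \<alpha> w + (1 - \<alpha>) p\<close>, the gap bound compares \<open>\<phi> q\<close> with the chord value
  \<open>\<phi> p + \<alpha> (\<phi> w - \<phi> p)\<close>; both the error and the increment of the chord are of order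
  \<open>\<alpha>\<close>, hence of order \<open>\<bar>q - p\<bar>\<close>.
\<close>

lemma Jensen_gap_imp_pointwise_Lipschitz:
  fixes \<phi> :: "real \<Rightarrow> real"
  assumes gap: "\<And>\<alpha>. 0 < \<alpha> \<Longrightarrow> \<alpha> < 1 \<Longrightarrow>
      \<bar>\<alpha> * \<phi> w + (1 - \<alpha>) * \<phi> p - \<phi> (\<alpha> * w + (1 - \<alpha>) * p)\<bar> \<le> \<alpha> * (1 - \<alpha>) * M"
  obtains C where "C \<ge> 0" "\<And>q. q \<in> closed_segment p w \<Longrightarrow> \<bar>\<phi> q - \<phi> p\<bar> \<le> C * \<bar>q - p\<bar>"
proof (cases "w = p")
  case True
  show ?thesis by (rule that[of 0]) (use True in auto)
next
  case False
  define K where "K = \<bar>\<phi> w - \<phi> p\<bar> + \<bar>M\<bar>"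
  show ?thesis
  proof (rule that[of "K / \<bar>w - p\<bar>"])
    show "K / \<bar>w - p\<bar> \<ge> 0" by (simp add: K_def)
    fix q assume "q \<in> closed_segment p w"
    then obtain \<alpha> where \<alpha>: "0 \<le> \<alpha>" "\<alpha> \<le> 1" and q: "q = \<alpha> * w + (1 - \<alpha>) * p"
      by (auto simp: in_segment algebra_simps)
    have "\<bar>\<phi> q - \<phi> p\<bar> \<le> \<alpha> * K"
    proof (cases "\<alpha> = 0 \<or> \<alpha> = 1")
      case True
      then show ?thesis by (auto simp: q K_def)
    next
      case False
      then have "0 < \<alpha>" "\<alpha> < 1" using \<alpha> by auto
      then have g: "\<bar>\<alpha> * \<phi> w + (1 - \<alpha>) * \<phi> p - \<phi> q\<bar> \<le> \<alpha> * (1 - \<alpha>) * M"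
        using gap q by simp
      have "\<alpha> * (1 - \<alpha>) * M \<le> \<alpha> * (1 - \<alpha>) * \<bar>M\<bar>"
        using \<alpha> by (intro mult_left_mono) auto
      also have "\<dots> \<le> \<alpha> * 1 * \<bar>M\<bar>"
        using \<alpha> by (intro mult_right_mono mult_left_mono) auto
      finally have M: "\<alpha> * (1 - \<alpha>) * M \<le> \<alpha> * \<bar>M\<bar>" by simp
      have "\<bar>\<phi> q - \<phi> p\<bar> \<le> \<bar>\<alpha> * (\<phi> w - \<phi> p)\<bar> + \<bar>\<alpha> * \<phi> w + (1 - \<alpha>) * \<phi> p - \<phi> q\<bar>"
        by (simp add: algebra_simps)
      also have "\<dots> \<le> \<alpha> * \<bar>\<phi> w - \<phi> p\<bar> + \<alpha> * \<bar>M\<bar>"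
        using g M \<alpha> by (simp add: abs_mult)
      finally show ?thesis by (simp add: K_def algebra_simps)
    qed
    moreover have "q - p = \<alpha> * (w - p)" by (simp add: q algebra_simps)
    then have "\<alpha> * K = K / \<bar>w - p\<bar> * \<bar>q - p\<bar>"
      using \<alpha> False by (simp add: abs_mult)
    ultimately show "\<bar>\<phi> q - \<phi> p\<bar> \<le> K / \<bar>w - p\<bar> * \<bar>q - p\<bar>" by simp
  qed
qed

lemma continuous_on_if_Jensen_gap_bounded:
  fixes \<phi> :: "real \<Rightarrow> real"
  assumes "h > 0"
    and gap: "\<And>u v \<alpha>. u \<in> {a..b} \<Longrightarrow> v \<in> {a..b} \<Longrightarrow> \<bar>u - v\<bar> \<le> h \<Longrightarrow> 0 < \<alpha> \<Longrightarrow> \<alpha> < 1 \<Longrightarrow>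
      \<bar>\<alpha> * \<phi> u + (1 - \<alpha>) * \<phi> v - \<phi> (\<alpha> * u + (1 - \<alpha>) * v)\<bar> \<le> \<alpha> * (1 - \<alpha>) * M"
  shows "continuous_on {a..b} \<phi>"
  unfolding continuous_on_iff
proof (intro ballI allI impI)
  fix p e :: real assume p: "p \<in> {a..b}" and "e > 0"
  obtain C1 where C1: "C1 \<ge> 0"
    "\<And>q. q \<in> closed_segment p (min b (p + h)) \<Longrightarrow> \<bar>\<phi> q - \<phi> p\<bar> \<le> C1 * \<bar>q - p\<bar>"
  proof (rule Jensen_gap_imp_pointwise_Lipschitz[of \<phi> "min b (p + h)" p M])
  qed (use p \<open>h > 0\<close> in \<open>auto intro!: gap\<close>)
  obtain C2 where C2: "C2 \<ge> 0"
    "\<And>q. q \<in> closed_segment p (max a (p - h)) \<Longrightarrow> \<bar>\<phi> q - \<phi> p\<bar> \<le> C2 * \<bar>q - p\<bar>"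
  proof (rule Jensen_gap_imp_pointwise_Lipschitz[of \<phi> "max a (p - h)" p M])
  qed (use p \<open>h > 0\<close> in \<open>auto intro!: gap\<close>)
  define C where "C = C1 + C2 + 1"
  have "C > 0" using C1(1) C2(1) by (simp add: C_def)
  have "dist (\<phi> q) (\<phi> p) < e" if q: "q \<in> {a..b}" "dist q p < min h (e / C)" for q
  proof -
    have "\<bar>\<phi> q - \<phi> p\<bar> \<le> C1 * \<bar>q - p\<bar> \<or> \<bar>\<phi> q - \<phi> p\<bar> \<le> C2 * \<bar>q - p\<bar>"
    proof (cases "q \<ge> p")
      case True
      then have "q \<in> closed_segment p (min b (p + h))"
        using q p \<open>h > 0\<close> by (auto simp: closed_segment_eq_real_ivl dist_real_def)
      then show ?thesis using C1(2) by blast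
    next
      case False
      then have "q \<in> closed_segment p (max a (p - h))"
        using q p \<open>h > 0\<close> by (auto simp: closed_segment_eq_real_ivl dist_real_def)
      then show ?thesis using C2(2) by blast
    qed
    moreover have "C1 * \<bar>q - p\<bar> \<le> C * \<bar>q - p\<bar>" "C2 * \<bar>q - p\<bar> \<le> C * \<bar>q - p\<bar>"
      using C1(1) C2(1) by (auto simp: C_def intro!: mult_right_mono)
    ultimately have "\<bar>\<phi> q - \<phi> p\<bar> \<le> C * \<bar>q - p\<bar>" by linarith
    also have "\<dots> < e"
      using q(2) \<open>C > 0\<close> by (simp add: dist_real_def field_simps)
    finally show ?thesis by (simp add: dist_real_def)
  qed
  moreover have "min h (e / C) > 0" using \<open>h > 0\<close> \<open>e > 0\<close> \<open>C > 0\<close> by simp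
  ultimately show "\<exists>d>0. \<forall>x'\<in>{a..b}. dist x' p < d \<longrightarrow> dist (\<phi> x') (\<phi> p) < e" by blast
qed

text \<open>
  If the maximum \<open>m\<close> were positive, it would be attained in the interior, and the set where
  it is attained would have a least element \<open>z\<close>. An interval of length \<open>h\<close> with \<open>z\<close> in its
  interior fits into \<open>[a, b]\<close>; its left end has a value below \<open>m\<close> and its right end a
  value at most \<open>m\<close>, so Jensen's inequality fails at \<open>z\<close>.
\<close>

lemma nonpos_if_convex_on_fixed_length:
  fixes g :: "real \<Rightarrow> real"
  assumes cont: "continuous_on {a..b} g" and h: "0 < h" "h \<le> b - a"
    and ends: "g a \<le> 0" "g b \<le> 0"
    and Jensen: "\<And>u \<alpha>. a \<le> u \<Longrightarrow> u + h \<le> b \<Longrightarrow> 0 < \<alpha> \<Longrightarrow> \<alpha> < 1 \<Longrightarrow>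
      g (u + \<alpha> * h) \<le> (1 - \<alpha>) * g u + \<alpha> * g (u + h)"
    and s: "s \<in> {a..b}"
  shows "g s \<le> 0"
proof (rule ccontr)
  assume "\<not> g s \<le> 0"
  obtain x where x: "x \<in> {a..b}" and max: "\<And>y. y \<in> {a..b} \<Longrightarrow> g y \<le> g x"
    using continuous_attains_sup[of "{a..b}" g] cont s by auto
  have "g x > 0" using max[OF s] \<open>\<not> g s \<le> 0\<close> by linarith
  define A where "A = {y \<in> {a..b}. g y = g x}"
  have "closed A"
    unfolding A_def by (intro continuous_closed_preimage_constant cont) auto
  moreover have "bounded A"
    by (rule bounded_subset[of "{a..b}"]) (auto simp: A_def)
  ultimately have "compact A" by (simp add: compact_eq_bounded_closed)
  moreover have "x \<in> A" using x by (simp add: A_def)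
  ultimately obtain z where z: "z \<in> A" and least: "\<And>y. y \<in> A \<Longrightarrow> z \<le> y"
    using compact_attains_inf[of A] by blast
  have gz: "g z = g x" and zab: "a \<le> z" "z \<le> b" using z by (auto simp: A_def)
  have "z \<noteq> a" "z \<noteq> b" using gz \<open>g x > 0\<close> ends by auto
  then have z': "a < z" "z < b" using zab by auto
  (* Centre the interval at z and shift it if it would leave [a, b]. *)
  define u where "u = min (b - h) (max a (z - h / 2))"
  have u: "a \<le> u" "u + h \<le> b" "u < z" "z < u + h"
    using z' h by (auto simp: u_def min_def max_def)
  define \<alpha> where "\<alpha> = (z - u) / h"
  have \<alpha>: "0 < \<alpha>" "\<alpha> < 1" using u h by (auto simp: \<alpha>_def field_simps)
  have "z = u + \<alpha> * h" using h by (simp add: \<alpha>_def)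
  then have "g x \<le> (1 - \<alpha>) * g u + \<alpha> * g (u + h)"
    using Jensen[OF u(1,2) \<alpha>] gz by simp
  moreover have "g u < g x"
  proof -
    have "u \<notin> A" using least[of u] u(3) by auto
    then show ?thesis using max[of u] u zab by (auto simp: A_def less_le)
  qed
  then have "(1 - \<alpha>) * g u < (1 - \<alpha>) * g x" using \<alpha> by simp
  moreover have "\<alpha> * g (u + h) \<le> \<alpha> * g x"
    using max[of "u + h"] u h \<alpha> by (intro mult_left_mono) auto
  ultimately show False by (simp add: algebra_simps)
qed

text \<open>
  The quadratic scaling. The parabola \<open>s (1 - s)\<close> exceeds its own chord over
  \<open>[u, u + h]\<close> by \<open>\<alpha> (1 - \<alpha>) h\<^sup>2\<close>, so that subtracting \<open>M / h\<^sup>2\<close> times this parabola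
  turns the gap bound on intervals of length \<open>h\<close> into Jensen's inequality.
\<close>

lemma Jensen_gap_scaling:
  fixes \<phi> :: "real \<Rightarrow> real"
  assumes h: "0 < h" "h \<le> 1"
    and gap: "\<And>u v \<alpha>. u \<in> {0..1} \<Longrightarrow> v \<in> {0..1} \<Longrightarrow> \<bar>u - v\<bar> \<le> h \<Longrightarrow> 0 < \<alpha> \<Longrightarrow> \<alpha> < 1 \<Longrightarrow>
      \<bar>\<alpha> * \<phi> u + (1 - \<alpha>) * \<phi> v - \<phi> (\<alpha> * u + (1 - \<alpha>) * v)\<bar> \<le> \<alpha> * (1 - \<alpha>) * M"
    and s: "s \<in> {0..1}"
  shows "\<bar>s * \<phi> 1 + (1 - s) * \<phi> 0 - \<phi> s\<bar> \<le> s * (1 - s) * (M / h\<^sup>2)"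
proof -
  have cont: "continuous_on {0..1} \<phi>"
    using continuous_on_if_Jensen_gap_bounded[OF h(1) gap] .
  have signed: "\<sigma> * (\<phi> s - s * \<phi> 1 - (1 - s) * \<phi> 0) - M / h\<^sup>2 * (s * (1 - s)) \<le> 0"
    if \<sigma>: "\<sigma> = 1 \<or> \<sigma> = -1" for \<sigma> :: real
  proof (rule nonpos_if_convex_on_fixed_length[where a = 0 and b = 1 and h = h and s = s
      and g = "\<lambda>s. \<sigma> * (\<phi> s - s * \<phi> 1 - (1 - s) * \<phi> 0) - M / h\<^sup>2 * (s * (1 - s))"])
    show "continuous_on {0..1} (\<lambda>s. \<sigma> * (\<phi> s - s * \<phi> 1 - (1 - s) * \<phi> 0) - M / h\<^sup>2 * (s * (1 - s)))"
      by (intro continuous_intros cont)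
    fix u \<alpha> :: real
    assume u: "0 \<le> u" "u + h \<le> 1" and \<alpha>: "0 < \<alpha>" "\<alpha> < 1"
    define c where "c = M / h\<^sup>2"
    have M: "M = c * h\<^sup>2" using h by (simp add: c_def)
    have "\<alpha> * (u + h) + (1 - \<alpha>) * u = u + \<alpha> * h" by (simp add: algebra_simps)
    then have "\<bar>\<alpha> * \<phi> (u + h) + (1 - \<alpha>) * \<phi> u - \<phi> (u + \<alpha> * h)\<bar> \<le> \<alpha> * (1 - \<alpha>) * M"
      using gap[of "u + h" u \<alpha>] u h \<alpha> by simp
    then have "\<sigma> * \<phi> (u + \<alpha> * h)
        \<le> \<sigma> * (\<alpha> * \<phi> (u + h) + (1 - \<alpha>) * \<phi> u) + \<alpha> * (1 - \<alpha>) * (c * h\<^sup>2)"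
      using \<sigma> unfolding M by auto
    then show "\<sigma> * (\<phi> (u + \<alpha> * h) - (u + \<alpha> * h) * \<phi> 1 - (1 - (u + \<alpha> * h)) * \<phi> 0)
          - M / h\<^sup>2 * ((u + \<alpha> * h) * (1 - (u + \<alpha> * h)))
        \<le> (1 - \<alpha>) * (\<sigma> * (\<phi> u - u * \<phi> 1 - (1 - u) * \<phi> 0) - M / h\<^sup>2 * (u * (1 - u)))
          + \<alpha> * (\<sigma> * (\<phi> (u + h) - (u + h) * \<phi> 1 - (1 - (u + h)) * \<phi> 0)
            - M / h\<^sup>2 * ((u + h) * (1 - (u + h))))"
      unfolding c_def[symmetric] by (simp add: algebra_simps power2_eq_square)
  qed (use h s in auto)
  show ?thesis
    using signed[of 1] signed[of "-1"] by (simp add: abs_le_iff algebra_simps)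
qed

section \<open>The global curvature bound\<close>

lemma global_curvature_bound_upper:
  assumes "x \<in> S" "y \<in> S" "0 < \<alpha>" "\<alpha> < 1" "norm (x - y) \<le> t"
  shows "ereal (\<bar>\<alpha> * f x + (1 - \<alpha>) * f y - f (\<alpha> *\<^sub>R x + (1 - \<alpha>) *\<^sub>R y)\<bar> / (\<alpha> * (1 - \<alpha>)))
    \<le> global_curvature_bound S f t"
  unfolding global_curvature_bound_def by (rule Sup_upper) (use assms in blast)

lemma global_curvature_bound_nonneg:
  assumes "x \<in> S" "0 \<le> t"
  shows "0 \<le> global_curvature_bound S f t"
proof -
  have "x = (1/2) *\<^sub>R x + (1 - 1/2) *\<^sub>R x" by (simp flip: scaleR_add_left)
  then show ?thesis
    using global_curvature_bound_upper[of x S x "1/2" t f] assms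
    by (simp flip: zero_ereal_def)
qed

text \<open>
  The scaling estimate as an upper bound for the curvature at the larger radius; the segment
  between two points of \<open>S\<close> is parametrised so that \<open>1\<close> goes to \<open>x\<close> and \<open>0\<close> to \<open>y\<close>,
  which makes the parameter equal to the weight \<open>\<alpha>\<close>.
\<close>

lemma global_curvature_bound_scaling_le:
  fixes S :: "'a::real_normed_vector set"
  assumes "convex S" and \<beta>: "0 < \<beta>" "\<beta> \<le> 1"
    and M: "global_curvature_bound S f (\<beta> * t) = ereal M"
  shows "global_curvature_bound S f t \<le> ereal (M / \<beta>\<^sup>2)"
proof -
  have "\<bar>\<alpha> * f x + (1 - \<alpha>) * f y - f (\<alpha> *\<^sub>R x + (1 - \<alpha>) *\<^sub>R y)\<bar> / (\<alpha> * (1 - \<alpha>)) \<le> M / \<beta>\<^sup>2"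
    if xy: "x \<in> S" "y \<in> S" and \<alpha>: "0 < \<alpha>" "\<alpha> < 1" and t: "norm (x - y) \<le> t" for x y \<alpha>
  proof -
    define p where "p s = s *\<^sub>R x + (1 - s) *\<^sub>R y" for s :: real
    have pS: "p s \<in> S" if "s \<in> {0..1}" for s
      using that xy \<open>convex S\<close> by (auto simp: p_def convex_def)
    have gap: "\<bar>l * f (p u) + (1 - l) * f (p v) - f (p (l * u + (1 - l) * v))\<bar> \<le> l * (1 - l) * M"
      if "u \<in> {0..1}" "v \<in> {0..1}" "\<bar>u - v\<bar> \<le> \<beta>" "0 < l" "l < 1" for u v l
    proof -
      have "p u - p v = (u - v) *\<^sub>R (x - y)" by (simp add: p_def algebra_simps)
      then have "norm (p u - p v) = \<bar>u - v\<bar> * norm (x - y)" by simp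
      also have "\<dots> \<le> \<beta> * t" using that t \<beta> by (intro mult_mono) auto
      finally have "norm (p u - p v) \<le> \<beta> * t" .
      moreover have "l *\<^sub>R p u + (1 - l) *\<^sub>R p v = p (l * u + (1 - l) * v)"
        by (simp add: p_def algebra_simps)
      ultimately have "\<bar>l * f (p u) + (1 - l) * f (p v) - f (p (l * u + (1 - l) * v))\<bar> / (l * (1 - l)) \<le> M"
        using global_curvature_bound_upper[of "p u" S "p v" l "\<beta> * t" f] pS that M by simp
      then show ?thesis using that by (simp add: divide_le_eq mult.commute)
    qed
    have "\<bar>\<alpha> * f (p 1) + (1 - \<alpha>) * f (p 0) - f (p \<alpha>)\<bar> \<le> \<alpha> * (1 - \<alpha>) * (M / \<beta>\<^sup>2)"
      by (rule Jensen_gap_scaling[of \<beta> "\<lambda>s. f (p s)" M \<alpha>, OF \<beta> gap]) (use \<alpha> in auto)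
    moreover have "p 1 = x" "p 0 = y" by (simp_all add: p_def)
    moreover have "0 < \<alpha> * (1 - \<alpha>)" using \<alpha> by simp
    ultimately show ?thesis
      by (subst pos_divide_le_eq) (simp_all only: p_def mult.commute)
  qed
  then show ?thesis
    by (subst (1) global_curvature_bound_def) (auto intro!: Sup_least)
qed

theorem lemma2:
  fixes S :: "'a::real_normed_vector set" and f :: "'a \<Rightarrow> real" and t \<beta> :: real
  assumes finite_dim: "\<exists>B::'a set. finite B \<and> span B = UNIV"
    and "convex S"
    and "curvature_regular S f"
    and "t \<in> diam_range S"
    and "\<beta> \<in> {0..1}"
  shows "global_curvature_bound S f (\<beta> * t) \<ge> ereal (\<beta>\<^sup>2) * global_curvature_bound S f t"
proof -
  have "S \<noteq> {}"
  proof
    assume "S = {}"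
    then have "global_curvature_bound S f t = - \<infinity>"
      by (simp add: global_curvature_bound_def bot_ereal_def)
    then show False
      using assms(3,4) by (auto simp: curvature_regular_def)
  qed
  then obtain x where x: "x \<in> S" by blast
  have "0 \<le> t" using assms(4) by (auto simp: diam_range_def split: if_splits)
  then have nonneg: "0 \<le> global_curvature_bound S f (\<beta> * t)"
    using assms(5) by (intro global_curvature_bound_nonneg[OF x]) auto
  show ?thesis
  proof (cases "\<beta> = 0")
    case True
    then show ?thesis using nonneg by (simp flip: zero_ereal_def)
  next
    case False
    then have \<beta>: "0 < \<beta>" "\<beta> \<le> 1" using assms(5) by auto
    show ?thesis
    proof (cases "global_curvature_bound S f (\<beta> * t)")
      case (real M)
      have "ereal (\<beta>\<^sup>2) * global_curvature_bound S f t \<le> ereal (\<beta>\<^sup>2) * ereal (M / \<beta>\<^sup>2)"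
        using global_curvature_bound_scaling_le[OF assms(2) \<beta> real]
        by (intro ereal_mult_left_mono) auto
      also have "\<dots> = ereal M" using \<beta> by simp
      finally show ?thesis using real by simp
    qed (use nonneg in auto)
  qed
qed

end
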